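(* Let $s$ be a nonzero integer and $n \ge 2$, and consider the Diophantine equation $$ \frac{1}{x_1} + \frac{1}{x_2} + \cdots + \frac{1}{x_n} = \frac{s}{x_1 x_2 \cdots x_n} $$ in nonzero integers $x_1, \dots, x_n$. (1) For those $(n,s)$ with $\gcd(s, M_n) = 1$, where $M_n = 1$ if $n$ is even and $M_n = 2$ if $n$ is odd, this equation has infinitely many integer solutions with at least two indices $i$ having $|x_i| \ge 2$ and with $\gcd(x_1 x_2 \cdots x_n, s) = 1$. For all remaining $(n,s)$, namely $n$ odd and $s$ even, this equation has no integer solutions with $\gcd(x_1 x_2 \cdots x_n, s) = 1$. (2) For each $n \ge 2$ there is a finite modulus $M_n^{\ast}$ such that whenever $\gcd(s, M_n^{\ast}) = 1$, this equation has infinitely many integer solutions satisfying $\min_i\{|x_i|\} \ge 2$ and $\gcd(x_1 x_2 \cdots x_n, s) = 1$. One can take $M_n^{\ast} = u_1 u_2 \cdots u_n$, where $u_i$ are the terms of Sylvester's sequence.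
   Context: Sylvester's sequence is defined by $u_1 = 2$ and $u_{n+1} = \left(\prod_{i=1}^n u_i\right) + 1$, i.e. $2, 3, 7, 43, 1807, \dots$. *)

theory Defs
  imports Complex_Main "HOL-Library.FuncSet"
begin

text \<open>Sylvester's sequence is indexed from 1; the value at index 0 is never used.\<close>

function sylvester :: "nat \<Rightarrow> nat" where
  "sylvester n = (\<Prod>i\<in>{1..<n}. sylvester i) + 1"
  by auto
termination
  by (relation "measure id") auto

declare sylvester.simps [simp del]

lemma sylvester_1: "sylvester 1 = 2"
  by (subst sylvester.simps) simp

lemma sylvester_Suc: "n \<ge> 1 \<Longrightarrow> sylvester (n + 1) = (\<Prod>i=1..n. sylvester i) + 1"
  by (subst sylvester.simps) (simp add: atLeastLessThanSuc_atLeastAtMost)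

definition parity_modulus :: "nat \<Rightarrow> int" where
  "parity_modulus n = (if even n then 1 else 2)"

definition sylvester_modulus :: "nat \<Rightarrow> int" where
  "sylvester_modulus n = int (\<Prod>i=1..n. sylvester i)"

text \<open>An $n$-tuple is an extensional function on \<open>{1..n}\<close>, so that distinct members
  of the set below are distinct tuples and \<open>infinite\<close> counts solutions.\<close>

definition coprime_solutions :: "nat \<Rightarrow> int \<Rightarrow> (nat \<Rightarrow> int) set" where
  "coprime_solutions n s =
     {x \<in> {1..n} \<rightarrow>\<^sub>E (UNIV - {0}).
        (\<Sum>i=1..n. 1 / rat_of_int (x i)) = rat_of_int s / (\<Prod>i=1..n. rat_of_int (x i)) \<and>
        gcd (\<Prod>i=1..n. x i) s = 1}"

end

theory Submission
  imports Defs "HOL-Number_Theory.Cong"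
begin

text \<open>
  Write \<open>P\<close> for the product of a tuple and \<open>t\<close> for \<open>P\<close> times the sum of its reciprocals. Appending
  \<open>y, z\<close> turns \<open>(P, t)\<close> into \<open>(P y z, t y z + P (y + z))\<close>. If \<open>t = 1\<close>, then the new second
  component \<open>y z + P (y + z)\<close> equals \<open>s\<close> iff \<open>(y + P) (z + P) = s + P\<^sup>2\<close>, and the
  factorisation \<open>1 \<sqdot> (s + P\<^sup>2)\<close> gives \<open>y = 1 - P\<close>, \<open>z = s + P\<^sup>2 - P\<close>. Iterating this with
  target \<open>1\<close>, from \<open>(a)\<close> with \<open>a \<equiv> -1\<close> or \<open>(a, 1 - a)\<close> with \<open>a \<equiv> 2\<close> modulo \<open>s\<close>, keeps
  \<open>P \<equiv> - u\<^sub>1 \<dots> u\<^sub>m\<^sub>-\<^sub>1\<close> modulo \<open>s\<close>, where \<open>m\<close> is the length of the tuple; a last step with target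
  \<open>s\<close> produces a tuple whose product has, modulo \<open>s\<close>, only Sylvester factors. Letting \<open>a\<close> grow
  gives infinitely many solutions. When entries \<open>\<plusminus>1\<close> are allowed, appending \<open>1, -1\<close> maps
  \<open>(P, t)\<close> to \<open>(-P, -t)\<close>, so lengths \<open>2\<close> and \<open>3\<close> suffice.
\<close>

section \<open>Tuples described by product and target\<close>

text \<open>Coprimality is left out so that the target \<open>t\<close> can differ from the modulus
  \<open>s\<close>: the iteration runs with \<open>t = 1\<close> before a last step to
  \<open>t = s\<close>.\<close>

definition recip_solution :: "nat \<Rightarrow> int \<Rightarrow> (nat \<Rightarrow> int) \<Rightarrow> bool" where
  "recip_solution n t x \<longleftrightarrow> x \<in> {1..n} \<rightarrow>\<^sub>E (UNIV - {0}) \<and>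
     (\<Sum>i=1..n. 1 / rat_of_int (x i)) * rat_of_int (\<Prod>i=1..n. x i) = rat_of_int t"

lemma coprime_solutions_iff:
  "x \<in> coprime_solutions n s \<longleftrightarrow> recip_solution n s x \<and> coprime (\<Prod>i=1..n. x i) s"
proof (cases "x \<in> {1..n} \<rightarrow>\<^sub>E (UNIV - {0})")
  case True
  then have "(\<Prod>i=1..n. rat_of_int (x i)) \<noteq> 0"
    by (auto simp: PiE_iff)
  then show ?thesis
    using True by (simp add: coprime_solutions_def recip_solution_def coprime_iff_gcd_eq_1 field_simps)
qed (simp add: coprime_solutions_def recip_solution_def)

lemma prod_append_two:
  fixes x :: "nat \<Rightarrow> int"
  shows "(\<Prod>i=1..Suc (Suc m). (x(Suc m := y, Suc (Suc m) := z)) i) = (\<Prod>i=1..m. x i) * y * z"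
proof -
  have "(\<Prod>i=1..m. (x(Suc m := y, Suc (Suc m) := z)) i) = (\<Prod>i=1..m. x i)"
    by (rule prod.cong) auto
  then show ?thesis by simp
qed

lemma recip_solution_append_two:
  assumes "recip_solution m t x" "y \<noteq> 0" "z \<noteq> 0"
  shows "recip_solution (Suc (Suc m)) (t * y * z + (\<Prod>i=1..m. x i) * (y + z))
           (x(Suc m := y, Suc (Suc m) := z))" (is "recip_solution _ _ ?x")
proof -
  define \<sigma> where "\<sigma> = (\<Sum>i=1..m. 1 / rat_of_int (x i))"
  define P where "P = (\<Prod>i=1..m. x i)"
  have \<sigma>: "\<sigma> * rat_of_int P = rat_of_int t"
    using assms(1) by (simp add: recip_solution_def \<sigma>_def P_def)
  have "(\<Sum>i=1..m. 1 / rat_of_int (?x i)) = \<sigma>"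
    unfolding \<sigma>_def by (rule sum.cong) auto
  then have "(\<Sum>i=1..Suc (Suc m). 1 / rat_of_int (?x i)) = \<sigma> + 1 / rat_of_int y + 1 / rat_of_int z"
    by simp
  moreover have "(\<sigma> + 1 / rat_of_int y + 1 / rat_of_int z) * rat_of_int (P * y * z)
      = \<sigma> * rat_of_int P * rat_of_int (y * z) + rat_of_int (P * (y + z))"
    using assms(2,3) by (simp add: field_simps)
  moreover have "?x \<in> {1..Suc (Suc m)} \<rightarrow>\<^sub>E (UNIV - {0})"
    using assms by (auto simp: recip_solution_def PiE_iff extensional_def)
  ultimately show ?thesis
    unfolding recip_solution_def prod_append_two \<sigma> P_def[symmetric] by (simp add: algebra_simps)
qed

lemma recip_solution_two:
  assumes "y \<noteq> 0" "z \<noteq> 0"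
  obtains x where "recip_solution 2 (y + z) x" "x 1 = y" "x 2 = z" "(\<Prod>i=1..2. x i) = y * z"
proof
  let ?x = "(\<lambda>_. undefined)(Suc 0 := y, Suc (Suc 0) := z)"
  \<comment> \<open>The pair extends the empty tuple, which has product \<open>1\<close> and target
    \<open>0\<close>, so the append formula yields the target \<open>y + z\<close>.\<close>
  have "recip_solution 0 0 (\<lambda>_. undefined)"
    by (simp add: recip_solution_def)
  from recip_solution_append_two[OF this assms]
  show "recip_solution 2 (y + z) ?x"
    by (simp add: numeral_2_eq_2)
  show "?x 1 = y" "?x 2 = z" "(\<Prod>i=1..2. ?x i) = y * z"
    using prod_append_two[where m = 0 and x = "\<lambda>_. undefined" and y = y and z = z] by (simp_all add: numeral_2_eq_2)
qed

text \<open>The slack \<open>3\<close> makes both new entries at least \<open>2\<close> in absolute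
  value; the last conclusion lets the size of the product survive iteration.\<close>

lemma recip_solution_step:
  fixes m :: nat and x :: "nat \<Rightarrow> int"
  defines "P \<equiv> \<Prod>i=1..m. x i"
  assumes x: "recip_solution m 1 x" "\<forall>i\<in>{1..m}. \<bar>x i\<bar> \<ge> 2" and large: "\<bar>P\<bar> \<ge> \<bar>t\<bar> + 3"
  obtains x' where "recip_solution (Suc (Suc m)) t x'" "\<forall>i\<in>{1..Suc (Suc m)}. \<bar>x' i\<bar> \<ge> 2"
    "(\<Prod>i=1..Suc (Suc m). x' i) = P * (1 - P) * (t + P\<^sup>2 - P)"
    "\<bar>\<Prod>i=1..Suc (Suc m). x' i\<bar> \<ge> \<bar>P\<bar>"
proof
  define y where "y = 1 - P"
  define z where "z = t + P\<^sup>2 - P"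
  let ?x = "x(Suc m := y, Suc (Suc m) := z)"
  have y: "\<bar>y\<bar> \<ge> 2" using large unfolding y_def by linarith
  \<comment> \<open>Consequently \<open>P\<^sup>2 - P\<close> is at least
    \<open>2 * \<bar>P\<bar>\<close>, which outweighs a negative \<open>t\<close>.\<close>
  have "3 * \<bar>P\<bar> \<le> \<bar>P\<bar> * \<bar>P\<bar>"
    using large by (intro mult_right_mono) auto
  then have "3 * \<bar>P\<bar> \<le> P\<^sup>2"
    by (simp add: power2_eq_square)
  then have z: "z \<ge> 2"
    using large unfolding z_def by linarith
  have "1 * y * z + P * (y + z) = t"
    by (simp add: y_def z_def algebra_simps power2_eq_square)
  then show "recip_solution (Suc (Suc m)) t ?x"
    using recip_solution_append_two[OF x(1), of y z] y z by (auto simp: P_def)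
  show "\<forall>i\<in>{1..Suc (Suc m)}. \<bar>?x i\<bar> \<ge> 2"
    using x(2) y z by auto
  show prod: "(\<Prod>i=1..Suc (Suc m). ?x i) = P * (1 - P) * (t + P\<^sup>2 - P)"
    unfolding prod_append_two by (simp add: y_def z_def P_def)
  have "\<bar>y * z\<bar> > 0"
    using y z by (auto simp: zero_less_abs_iff)
  then have "\<bar>P\<bar> * 1 \<le> \<bar>P\<bar> * \<bar>y * z\<bar>"
    by (intro mult_left_mono) linarith+
  then show "\<bar>\<Prod>i=1..Suc (Suc m). ?x i\<bar> \<ge> \<bar>P\<bar>"
    unfolding prod by (simp add: y_def z_def abs_mult mult.assoc)
qed

section \<open>Large tuples with target \<open>1\<close> in a fixed residue class\<close>

lemma exists_large_residue:
  fixes s r B :: int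
  assumes "s \<noteq> 0"
  obtains a where "[a = r] (mod s)" "\<bar>a\<bar> \<ge> B"
proof
  \<comment> \<open>Since \<open>\<bar>s\<bar>\<close> is at least 1, the added multiple has size at
    least \<open>\<bar>r\<bar> + \<bar>B\<bar>\<close>; adding \<open>r\<close> leaves at least
    \<open>\<bar>B\<bar>\<close>.\<close>
  show "[r + (\<bar>r\<bar> + \<bar>B\<bar>) * s = r] (mod s)"
    by (simp add: cong_iff_dvd_diff)
  have "(\<bar>r\<bar> + \<bar>B\<bar>) * 1 \<le> (\<bar>r\<bar> + \<bar>B\<bar>) * \<bar>s\<bar>"
    using assms by (intro mult_left_mono) auto
  then have "\<bar>r\<bar> + \<bar>B\<bar> \<le> \<bar>(\<bar>r\<bar> + \<bar>B\<bar>) * s\<bar>"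
    by (simp add: abs_mult)
  then show "\<bar>r + (\<bar>r\<bar> + \<bar>B\<bar>) * s\<bar> \<ge> B"
    by linarith
qed

lemma int_sylvester: "int (sylvester m) = (\<Prod>i\<in>{1..<m}. int (sylvester i)) + 1"
  by (subst sylvester.simps) simp

text \<open>The step mirrors Sylvester's recurrence: if P is congruent to -W with W = u_1 ...
  u_(m-1), then 1 - P is congruent to W + 1 = u_m, and 1 + P^2 - P to W(W + 1) + 1 =
  u_(m+1).\<close>

lemma unit_solutions_unbounded:
  fixes s B :: int
  assumes "s \<noteq> 0" "m \<ge> 1"
  shows "\<exists>x. recip_solution m 1 x \<and> (\<forall>i\<in>{1..m}. \<bar>x i\<bar> \<ge> 2) \<and> \<bar>\<Prod>i=1..m. x i\<bar> \<ge> B \<and>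
           [(\<Prod>i=1..m. x i) = - (\<Prod>i\<in>{1..<m}. int (sylvester i))] (mod s)"
  using assms(2)
proof (induction m arbitrary: B rule: induct_nat_012)
  case 1
  obtain a where a: "[a = -1] (mod s)" "\<bar>a\<bar> \<ge> max B 2"
    using exists_large_residue[OF assms(1)] by metis
  define x :: "nat \<Rightarrow> int" where "x = (\<lambda>_. undefined)(1 := a)"
  have "x 1 = a" "recip_solution 1 1 x"
    using a by (auto simp: x_def recip_solution_def PiE_iff extensional_def)
  with a show ?case
    by (intro exI[of _ x]) auto
next
  case (ge2 m)
  show ?case
  proof (cases "m = 0")
    \<comment> \<open>Length 2 is a second base case, since the empty tuple has target
      \<open>0\<close>, not \<open>1\<close>. The residue \<open>2\<close> gives the product -2 =
      -u_1, and the bound \<open>3\<close> makes \<open>\<bar>1 - a\<bar>\<close> at least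
      2.\<close>
    case True
    obtain a where a: "[a = 2] (mod s)" "\<bar>a\<bar> \<ge> max B 3"
      using exists_large_residue[OF assms(1)] by metis
    have "a \<noteq> 0" "1 - a \<noteq> 0" using a(2) by auto
    then obtain x where x: "recip_solution 2 (a + (1 - a)) x" "x 1 = a" "x 2 = 1 - a"
        "(\<Prod>i=1..2. x i) = a * (1 - a)"
      by (rule recip_solution_two)
    have "\<bar>a\<bar> * 1 \<le> \<bar>a\<bar> * \<bar>1 - a\<bar>"
      using a(2) by (intro mult_left_mono) auto
    then have "\<bar>a * (1 - a)\<bar> \<ge> B"
      using a(2) by (simp add: abs_mult)
    moreover have "[a * (1 - a) = 2 * (1 - 2)] (mod s)"
      by (intro cong_mult cong_diff a(1) cong_refl)
    moreover have "\<forall>i\<in>{1..2}. \<bar>x i\<bar> \<ge> 2"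
    proof
      fix i :: nat assume "i \<in> {1..2}"
      then have "i = 1 \<or> i = 2" by auto
      then show "\<bar>x i\<bar> \<ge> 2" using x(2,3) a(2) by auto
    qed
    moreover have "{1..<2} = {1::nat}" by auto
    ultimately show ?thesis
      using x sylvester_1 True by (intro exI[of _ x]) (simp add: numeral_2_eq_2)
  next
    case False
    define W where "W = (\<Prod>i\<in>{1..<m}. int (sylvester i))"
    \<comment> \<open>The \<open>4\<close> is the size \<open>\<bar>t\<bar> + 3\<close> that the
      step demands for \<open>t = 1\<close>.\<close>
    obtain x where x: "recip_solution m 1 x" "\<forall>i\<in>{1..m}. \<bar>x i\<bar> \<ge> 2"
      and large: "\<bar>\<Prod>i=1..m. x i\<bar> \<ge> max B 4" and cong: "[(\<Prod>i=1..m. x i) = - W] (mod s)"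
      using ge2.IH(1)[of "max B 4"] False unfolding W_def by auto
    define P where "P = (\<Prod>i=1..m. x i)"
    have "\<bar>\<Prod>i=1..m. x i\<bar> \<ge> \<bar>1\<bar> + 3"
      using large by simp
    from recip_solution_step[OF x this]
    obtain x' where x': "recip_solution (Suc (Suc m)) 1 x'" "\<forall>i\<in>{1..Suc (Suc m)}. \<bar>x' i\<bar> \<ge> 2"
      "(\<Prod>i=1..Suc (Suc m). x' i) = P * (1 - P) * (1 + P\<^sup>2 - P)"
      "\<bar>\<Prod>i=1..Suc (Suc m). x' i\<bar> \<ge> \<bar>P\<bar>"
      unfolding P_def by blast
    have "[P * (1 - P) * (1 + P\<^sup>2 - P) = (- W) * (1 - (- W)) * (1 + (- W)\<^sup>2 - (- W))] (mod s)"
      using cong unfolding P_def by (intro cong_mult cong_diff cong_add cong_pow cong_refl)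
    moreover have "(\<Prod>i\<in>{1..<Suc (Suc m)}. int (sylvester i)) = W * (W + 1) * (W * (W + 1) + 1)"
      using False int_sylvester[of m] int_sylvester[of "Suc m"]
      by (simp add: W_def)
    ultimately have "[(\<Prod>i=1..Suc (Suc m). x' i) = - (\<Prod>i\<in>{1..<Suc (Suc m)}. int (sylvester i))] (mod s)"
      unfolding x'(3) by (simp add: algebra_simps power2_eq_square)
    moreover have "\<bar>\<Prod>i=1..Suc (Suc m). x' i\<bar> \<ge> B"
      using x'(4) large unfolding P_def by linarith
    ultimately show ?thesis
      using x'(1,2) by blast
  qed
qed simp

section \<open>Solutions without entries \<open>1\<close> and \<open>-1\<close>\<close>

text \<open>With m = n - 2, the last step has target s, which is 0 modulo s, so it turns P = -W into
  -(W(W + 1))^2 modulo s, and W(W + 1) = u_1 ... u_(n-2).\<close>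

lemma coprime_solutions_unbounded:
  fixes s B :: int
  assumes "n \<ge> 2" "s \<noteq> 0" and cop: "coprime s (\<Prod>i=1..n-2. int (sylvester i))"
  shows "\<exists>x\<in>coprime_solutions n s. (\<forall>i\<in>{1..n}. \<bar>x i\<bar> \<ge> 2) \<and> \<bar>\<Prod>i=1..n. x i\<bar> \<ge> B"
proof (cases "n = 2")
  case True
  \<comment> \<open>The pair \<open>a\<close>, \<open>s - a\<close> has target \<open>s\<close>; the
    residue \<open>1\<close> makes its product congruent to -1, hence coprime to
    \<open>s\<close>.\<close>
  obtain a where a: "[a = 1] (mod s)" "\<bar>a\<bar> \<ge> \<bar>B\<bar> + \<bar>s\<bar> + 2"
    using exists_large_residue[OF assms(2)] by metis
  have "a \<noteq> 0" "s - a \<noteq> 0" using a(2) by auto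
  then obtain x where x: "recip_solution 2 (a + (s - a)) x" "x 1 = a" "x 2 = s - a"
      "(\<Prod>i=1..2. x i) = a * (s - a)"
    by (rule recip_solution_two)
  have "\<bar>a\<bar> * 1 \<le> \<bar>a\<bar> * \<bar>s - a\<bar>"
    using a(2) by (intro mult_left_mono) auto
  then have "\<bar>a * (s - a)\<bar> \<ge> B"
    using a(2) by (simp add: abs_mult)
  moreover have "[a * (s - a) = 1 * (0 - 1)] (mod s)"
    by (intro cong_mult cong_diff a(1)) (simp add: cong_iff_dvd_diff)
  then have "coprime (a * (s - a)) s"
    using cong_imp_coprime[OF cong_sym] by fastforce
  moreover have "\<forall>i\<in>{1..2}. \<bar>x i\<bar> \<ge> 2"
  proof
    fix i :: nat assume "i \<in> {1..2}"
    then have "i = 1 \<or> i = 2" by auto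
    then show "\<bar>x i\<bar> \<ge> 2" using x(2,3) a(2) by auto
  qed
  ultimately show ?thesis
    using x True by (intro bexI[of _ x]) (auto simp: coprime_solutions_iff)
next
  case False
  define m where "m = n - 2"
  have m: "m \<ge> 1" "n = Suc (Suc m)" using False assms(1) by (auto simp: m_def)
  define W where "W = (\<Prod>i\<in>{1..<m}. int (sylvester i))"
  have "{1..m} = insert m {1..<m}" using m by auto
  then have cop': "coprime s (W * (W + 1))"
    using cop int_sylvester[of m] by (simp add: m_def[symmetric] W_def mult.commute)
  obtain x where x: "recip_solution m 1 x" "\<forall>i\<in>{1..m}. \<bar>x i\<bar> \<ge> 2"
    and large: "\<bar>\<Prod>i=1..m. x i\<bar> \<ge> \<bar>B\<bar> + \<bar>s\<bar> + 3" and cong: "[(\<Prod>i=1..m. x i) = - W] (mod s)"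
    using unit_solutions_unbounded[OF assms(2) m(1), of "\<bar>B\<bar> + \<bar>s\<bar> + 3"] unfolding W_def by auto
  define P where "P = (\<Prod>i=1..m. x i)"
  have "\<bar>\<Prod>i=1..m. x i\<bar> \<ge> \<bar>s\<bar> + 3"
    using large by linarith
  from recip_solution_step[OF x this]
  obtain x' where x': "recip_solution n s x'" "\<forall>i\<in>{1..n}. \<bar>x' i\<bar> \<ge> 2"
    "(\<Prod>i=1..n. x' i) = P * (1 - P) * (s + P\<^sup>2 - P)" "\<bar>\<Prod>i=1..n. x' i\<bar> \<ge> \<bar>P\<bar>"
    unfolding P_def m(2) by blast
  have "[P * (1 - P) * (s + P\<^sup>2 - P) = (- W) * (1 - (- W)) * (0 + (- W)\<^sup>2 - (- W))] (mod s)"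
    using cong unfolding P_def
    by (intro cong_mult cong_diff cong_add cong_pow cong_refl) (auto simp: cong_iff_dvd_diff)
  moreover have "(- W) * (1 - (- W)) * (0 + (- W)\<^sup>2 - (- W)) = - ((W * (W + 1)) * (W * (W + 1)))"
    by (simp add: algebra_simps power2_eq_square)
  moreover have "coprime (- ((W * (W + 1)) * (W * (W + 1)))) s"
    using cop' by (simp add: coprime_commute)
  ultimately have "coprime (\<Prod>i=1..n. x' i) s"
    unfolding x'(3) by (metis cong_imp_coprime cong_sym)
  moreover have "\<bar>\<Prod>i=1..n. x' i\<bar> \<ge> B"
    using x'(4) large unfolding P_def by linarith
  ultimately show ?thesis
    using x' by (auto simp: coprime_solutions_iff)
qed

section \<open>Solutions with at least two large entries\<close>

text \<open>For lengths 2 and 3 the product u_1 ... u_(n-2) is 1 and 2, which is exactly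
  \<open>parity_modulus n\<close>.\<close>

lemma coprime_solutions_two_large_unbounded:
  fixes s B :: int
  assumes "n \<ge> 2" "s \<noteq> 0" "coprime s (parity_modulus n)"
  shows "\<exists>x\<in>coprime_solutions n s. card {i \<in> {1..n}. \<bar>x i\<bar> \<ge> 2} \<ge> 2 \<and> \<bar>\<Prod>i=1..n. x i\<bar> \<ge> B"
  using assms
proof (induction n arbitrary: s rule: induct_nat_012)
  case (ge2 m)
  show ?case
  proof (cases "m \<le> 1")
    case True
    then have "m = 0 \<or> m = 1" by auto
    then have "coprime s (\<Prod>i=1..Suc (Suc m) - 2. int (sylvester i))"
      using ge2.prems(3) sylvester_1 by (auto simp: parity_modulus_def)
    from coprime_solutions_unbounded[OF _ ge2.prems(2) this, of B]
    obtain x where x: "x \<in> coprime_solutions (Suc (Suc m)) s"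
      "\<forall>i\<in>{1..Suc (Suc m)}. \<bar>x i\<bar> \<ge> 2" "\<bar>\<Prod>i=1..Suc (Suc m). x i\<bar> \<ge> B"
      by auto
    from x(2) have "{i \<in> {1..Suc (Suc m)}. \<bar>x i\<bar> \<ge> 2} = {1..Suc (Suc m)}"
      by blast
    then show ?thesis using x by (intro bexI[of _ x]) auto
  next
    case False
    \<comment> \<open>Appending \<open>1, -1\<close> negates the target, so the shorter tuple must
      solve the equation for \<open>- s\<close>.\<close>
    then obtain x where x: "x \<in> coprime_solutions m (- s)"
        "card {i \<in> {1..m}. \<bar>x i\<bar> \<ge> 2} \<ge> 2" "\<bar>\<Prod>i=1..m. x i\<bar> \<ge> B"
      using ge2.IH(1)[of "- s"] ge2.prems by (auto simp: parity_modulus_def)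
    let ?x = "x(Suc m := 1, Suc (Suc m) := -1)"
    have prod: "(\<Prod>i=1..Suc (Suc m). ?x i) = - (\<Prod>i=1..m. x i)"
      unfolding prod_append_two by simp
    have "?x \<in> coprime_solutions (Suc (Suc m)) s"
      using x(1) recip_solution_append_two[of m "- s" x 1 "-1"]
      unfolding coprime_solutions_iff prod by simp
    moreover have "card {i \<in> {1..m}. \<bar>x i\<bar> \<ge> 2} \<le> card {i \<in> {1..Suc (Suc m)}. \<bar>?x i\<bar> \<ge> 2}"
      by (rule card_mono) auto
    moreover have "\<bar>\<Prod>i=1..Suc (Suc m). ?x i\<bar> \<ge> B"
      unfolding prod using x(3) by simp
    ultimately show ?thesis
      using x(2) by (intro bexI[of _ ?x]) auto
  qed
qed auto

section \<open>The parity obstruction\<close>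

text \<open>Product times reciprocal sum is a sum of \<open>n\<close> products of
  \<open>n - 1\<close> odd entries each, hence congruent to \<open>n\<close> modulo 2.\<close>

lemma recip_sum_odd_parity:
  fixes x :: "nat \<Rightarrow> int"
  assumes "\<forall>i\<in>{1..n}. odd (x i)"
  shows "\<exists>e. (\<Sum>i=1..n. 1 / rat_of_int (x i)) * rat_of_int (\<Prod>i=1..n. x i) = rat_of_int e \<and>
           (odd e \<longleftrightarrow> odd n)"
  using assms
proof (induction n)
  case (Suc n)
  define P where "P = (\<Prod>i=1..n. x i)"
  define \<sigma> where "\<sigma> = (\<Sum>i=1..n. 1 / rat_of_int (x i))"
  from Suc obtain e where e: "\<sigma> * rat_of_int P = rat_of_int e" "odd e \<longleftrightarrow> odd n"
    unfolding \<sigma>_def P_def by auto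
  have odd: "odd P" "odd (x (Suc n))"
    unfolding P_def using Suc.prems by (auto simp: even_prod_iff)
  then have "x (Suc n) \<noteq> 0" by auto
  then have "(\<sigma> + 1 / rat_of_int (x (Suc n))) * rat_of_int (P * x (Suc n))
      = \<sigma> * rat_of_int P * rat_of_int (x (Suc n)) + rat_of_int P"
    by (simp add: field_simps)
  also have "\<dots> = rat_of_int (e * x (Suc n) + P)"
    unfolding e by simp
  finally show ?case
    using e(2) odd by (intro exI[of _ "e * x (Suc n) + P"]) (simp add: \<sigma>_def P_def)
qed simp

text \<open>Coprimality to an even \<open>s\<close> forces every entry to be odd, and then
  \<open>s\<close> would have the parity of \<open>n\<close>.\<close>

lemma coprime_solutions_empty:
  assumes "odd n" "even s"
  shows "coprime_solutions n s = {}"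
proof (rule equals0I)
  fix x assume x: "x \<in> coprime_solutions n s"
  then have "odd (\<Prod>i=1..n. x i)"
    using assms(2) by (auto simp: coprime_solutions_iff dest: coprime_common_divisor[of _ _ 2])
  then have "\<forall>i\<in>{1..n}. odd (x i)"
    by (auto simp: even_prod_iff)
  from recip_sum_odd_parity[OF this] have "odd s"
    using x assms(1) by (auto simp: coprime_solutions_iff recip_solution_def)
  with assms(2) show False by simp
qed

section \<open>From unbounded products to infinitely many solutions\<close>

lemma infinite_if_abs_unbounded:
  fixes f :: "'a \<Rightarrow> int"
  assumes "\<And>B. \<exists>x\<in>A. \<bar>f x\<bar> \<ge> B"
  shows "infinite A"
proof
  assume "finite A"
  obtain x where "x \<in> A" "\<bar>f x\<bar> \<ge> Max ((\<lambda>x. \<bar>f x\<bar>) ` A) + 1"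
    using assms by blast
  moreover from this \<open>finite A\<close> have "\<bar>f x\<bar> \<le> Max ((\<lambda>x. \<bar>f x\<bar>) ` A)"
    by (intro Max_ge) auto
  ultimately show False by simp
qed

theorem theorem4p2:
  fixes n :: nat
  assumes "n \<ge> 2"
  shows
    "(\<forall>s::int. s \<noteq> 0 \<longrightarrow>
        (gcd s (parity_modulus n) = 1 \<longrightarrow>
           infinite {x \<in> coprime_solutions n s. card {i \<in> {1..n}. \<bar>x i\<bar> \<ge> 2} \<ge> 2}) \<and>
        (gcd s (parity_modulus n) \<noteq> 1 \<longleftrightarrow> odd n \<and> even s) \<and>
        (odd n \<and> even s \<longrightarrow> coprime_solutions n s = {}))
     \<and> (\<exists>M::int. M > 0 \<and>
        (\<forall>s::int. s \<noteq> 0 \<longrightarrow> gcd s M = 1 \<longrightarrow>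
           infinite {x \<in> coprime_solutions n s. Min ((\<lambda>i. \<bar>x i\<bar>) ` {1..n}) \<ge> 2}))
     \<and> (\<forall>s::int. s \<noteq> 0 \<longrightarrow> gcd s (sylvester_modulus n) = 1 \<longrightarrow>
           infinite {x \<in> coprime_solutions n s. Min ((\<lambda>i. \<bar>x i\<bar>) ` {1..n}) \<ge> 2})"
proof -
  have two_large: "infinite {x \<in> coprime_solutions n s. card {i \<in> {1..n}. \<bar>x i\<bar> \<ge> 2} \<ge> 2}"
    if "s \<noteq> 0" "gcd s (parity_modulus n) = 1" for s
    using coprime_solutions_two_large_unbounded[OF assms that(1)] that(2)
    by (intro infinite_if_abs_unbounded[of _ "\<lambda>x. \<Prod>i=1..n. x i"]) (auto simp: coprime_iff_gcd_eq_1)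
  have parity: "gcd s (parity_modulus n) \<noteq> 1 \<longleftrightarrow> odd n \<and> even s" for s
    by (auto simp: parity_modulus_def simp flip: coprime_iff_gcd_eq_1)
  have all_large: "infinite {x \<in> coprime_solutions n s. Min ((\<lambda>i. \<bar>x i\<bar>) ` {1..n}) \<ge> 2}"
    if "s \<noteq> 0" "gcd s (sylvester_modulus n) = 1" for s
  proof -
    \<comment> \<open>Coprimality to the full modulus passes to its divisor u_1 ... u_(n-2).\<close>
    have "(\<Prod>i=1..n-2. int (sylvester i)) dvd sylvester_modulus n"
      unfolding sylvester_modulus_def of_nat_prod by (intro prod_dvd_prod_subset) auto
    with that(2) have "coprime s (\<Prod>i=1..n-2. int (sylvester i))"
      by (metis coprime_divisors coprime_iff_gcd_eq_1 dvd_refl)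
    note unbounded = coprime_solutions_unbounded[OF assms that(1) this]
    have "Min ((\<lambda>i. \<bar>x i\<bar>) ` {1..n}) \<ge> 2 \<longleftrightarrow> (\<forall>i\<in>{1..n}. \<bar>x i\<bar> \<ge> 2)" for x :: "nat \<Rightarrow> int"
      using assms by (subst Min_ge_iff) auto
    then show ?thesis
      using unbounded
      by (intro infinite_if_abs_unbounded[of _ "\<lambda>x. \<Prod>i=1..n. x i"]) (simp add: Bex_def conj_assoc)
  qed
  have "sylvester i > 0" for i
    by (subst sylvester.simps) simp
  then have "sylvester_modulus n > 0"
    by (auto simp: sylvester_modulus_def intro!: prod_pos)
  with all_large have "\<exists>M::int. M > 0 \<and>
      (\<forall>s::int. s \<noteq> 0 \<longrightarrow> gcd s M = 1 \<longrightarrow>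
         infinite {x \<in> coprime_solutions n s. Min ((\<lambda>i. \<bar>x i\<bar>) ` {1..n}) \<ge> 2})"
    by (intro exI[of _ "sylvester_modulus n"]) simp
  then show ?thesis
    using two_large parity coprime_solutions_empty all_large by (intro conjI allI impI) simp_all
qed

end
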